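(* Each of the nine sets $UT_n, SUT_n, UF_n, SUF_n, LT_n, SLT_n, LF_n, SLF_n, D_n$ is a subsemigroup of $M_n$. The sets $UT_n$, $UF_n$, $LT_n$, $LF_n$, $D_n$ contain $\mathbf{1}$ and are submonoids of $M_n$, and removing $\mathbf{1}$ from any of these five sets yields a subsemigroup of $S_n=M_n\setminus\{\mathbf{1}\}$. Finally, $SUT_n$, $SUF_n$, $SLT_n$, $SLF_n$ consist solely of nilpotents, each nonzero element $\langle d,k,m\rangle$ of them having nilpotency index $1+\lceil (m-k+1)/|d|\rceil$.
   Context: Fix an integer $n\ge 2$. For integers $d,k,m$ with $1-\min(0,d)\le k\le m\le n-\max(0,d)$, let $\langle d,k,m\rangle$ denote the $n\times n$ matrix with entries $x_{ij}$ ($i,j\in\{1,\dots,n\}$) equal to $1$ if $k\le i\le m$ and $j-i=d$, and $0$ otherwise. Let $\mathbf{0}$ be the $n\times n$ zero matrix, $M_n=\{\mathbf{0}\}\cup\{\langle d,k,m\rangle: d\in\mathbb{Z},\ k,m\in\mathbb{N},\ 1-\min(0,d)\le k\le m\le n-\max(0,d)\}$ (a monoid under matrix multiplication with identity $\mathbf{1}=\langle 0,1,n\rangle$), and $S_n=M_n\setminus\{\mathbf{1}\}$. Each of the following sets consists of $\mathbf{0}$ together with the nonzero $\langle d,k,m\rangle\in M_n$ satisfying the stated restriction: $UT_n$: $d\ge0$; $SUT_n$: $d>0$; $UF_n$: $d\ge0$, $k=1$, $m=n-d$; $SUF_n$: $d>0$, $k=1$, $m=n-d$; $LT_n$: $d\le0$;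 $SLT_n$: $d<0$; $LF_n$: $d\le 0$, $k=1-d$, $m=n$; $SLF_n$: $d<0$, $k=1-d$, $m=n$; $D_n$: $d=0$. A submonoid of $M_n$ is a subsemigroup containing $\mathbf{1}$. The nilpotency index of a nilpotent $x$ is the least $j\in\mathbb{N}$ with $x^j=\mathbf{0}$. *)

theory Defs
  imports "Jordan_Normal_Form.Matrix"
begin

definition admissible :: "nat \<Rightarrow> int \<Rightarrow> int \<Rightarrow> int \<Rightarrow> bool" where
  "admissible n d k m \<longleftrightarrow> 1 - min 0 d \<le> k \<and> k \<le> m \<and> m \<le> int n - max 0 d"

text \<open>The matrix \<open>\<langle>d,k,m\<rangle>\<close>. Matrix indices in the library start at 0, so the library position
  \<open>(i, j)\<close> is the position \<open>(i + 1, j + 1)\<close> in the usual numbering. The entries may lie in an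
  arbitrary semiring with \<open>0 \<noteq> 1\<close>.\<close>

definition seg :: "nat \<Rightarrow> int \<Rightarrow> int \<Rightarrow> int \<Rightarrow> 'a::semiring_1 mat" where
  "seg n d k m = mat n n (\<lambda>(i, j).
     if k \<le> int i + 1 \<and> int i + 1 \<le> m \<and> (int j + 1) - (int i + 1) = d then 1 else 0)"

definition restricted :: "nat \<Rightarrow> (int \<Rightarrow> int \<Rightarrow> int \<Rightarrow> bool) \<Rightarrow> 'a::semiring_1 mat set" where
  "restricted n P = insert (0\<^sub>m n n) {seg n d k m | d k m. admissible n d k m \<and> P d k m}"

definition M_set :: "nat \<Rightarrow> 'a::semiring_1 mat set" where
  "M_set n = restricted n (\<lambda>d k m. True)"

definition S_set :: "nat \<Rightarrow> 'a::semiring_1 mat set" where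
  "S_set n = M_set n - {1\<^sub>m n}"

definition UT_set :: "nat \<Rightarrow> 'a::semiring_1 mat set" where
  "UT_set n = restricted n (\<lambda>d k m. d \<ge> 0)"

definition SUT_set :: "nat \<Rightarrow> 'a::semiring_1 mat set" where
  "SUT_set n = restricted n (\<lambda>d k m. d > 0)"

definition UF_set :: "nat \<Rightarrow> 'a::semiring_1 mat set" where
  "UF_set n = restricted n (\<lambda>d k m. d \<ge> 0 \<and> k = 1 \<and> m = int n - d)"

definition SUF_set :: "nat \<Rightarrow> 'a::semiring_1 mat set" where
  "SUF_set n = restricted n (\<lambda>d k m. d > 0 \<and> k = 1 \<and> m = int n - d)"

definition LT_set :: "nat \<Rightarrow> 'a::semiring_1 mat set" where
  "LT_set n = restricted n (\<lambda>d k m. d \<le> 0)"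

definition SLT_set :: "nat \<Rightarrow> 'a::semiring_1 mat set" where
  "SLT_set n = restricted n (\<lambda>d k m. d < 0)"

definition LF_set :: "nat \<Rightarrow> 'a::semiring_1 mat set" where
  "LF_set n = restricted n (\<lambda>d k m. d \<le> 0 \<and> k = 1 - d \<and> m = int n)"

definition SLF_set :: "nat \<Rightarrow> 'a::semiring_1 mat set" where
  "SLF_set n = restricted n (\<lambda>d k m. d < 0 \<and> k = 1 - d \<and> m = int n)"

definition D_set :: "nat \<Rightarrow> 'a::semiring_1 mat set" where
  "D_set n = restricted n (\<lambda>d k m. d = 0)"

definition M_monoid :: "nat \<Rightarrow> 'a::semiring_1 mat monoid" where
  "M_monoid n = \<lparr>carrier = M_set n, mult = (*), one = 1\<^sub>m n\<rparr>"

definition subsemigroup :: "'a::semiring_1 mat set \<Rightarrow> 'a mat set \<Rightarrow> bool" where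
  "subsemigroup T S \<longleftrightarrow> T \<subseteq> S \<and> T \<noteq> {} \<and> (\<forall>x\<in>T. \<forall>y\<in>T. x * y \<in> T)"

definition nilpotent_mat :: "nat \<Rightarrow> 'a::semiring_1 mat \<Rightarrow> bool" where
  "nilpotent_mat n x \<longleftrightarrow> (\<exists>j::nat. j \<ge> 1 \<and> x ^\<^sub>m j = 0\<^sub>m n n)"

definition nilpotency_index :: "nat \<Rightarrow> 'a::semiring_1 mat \<Rightarrow> nat" where
  "nilpotency_index n x = (LEAST j. j \<ge> 1 \<and> x ^\<^sub>m j = 0\<^sub>m n n)"

lemma seg_carrier [simp]: "seg n d k m \<in> carrier_mat n n"
  by (simp add: seg_def)

lemma one_eq_seg: "1\<^sub>m n = seg n 0 1 (int n)"
  by (rule eq_matI) (auto simp: seg_def)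

lemma seg_empty: "m < k \<Longrightarrow> seg n d k m = 0\<^sub>m n n"
  by (rule eq_matI) (auto simp: seg_def)

lemma seg_mult:
  assumes "admissible n d k m"
  shows "seg n d k m * (seg n d' k' m' :: 'a::semiring_1 mat)
       = seg n (d + d') (max k (k' - d)) (min m (m' - d))"
proof (rule eq_matI)
  fix i j
  assume "i < dim_row (seg n (d + d') (max k (k' - d)) (min m (m' - d)) :: 'a mat)"
    and "j < dim_col (seg n (d + d') (max k (k' - d)) (min m (m' - d)) :: 'a mat)"
  then have ij: "i < n" "j < n" by (auto simp: seg_def)
  let ?A = "seg n d k m :: 'a mat" and ?B = "seg n d' k' m' :: 'a mat"
  have e: "(?A * ?B) $$ (i, j) = (\<Sum>l<n. ?A $$ (i, l) * ?B $$ (l, j))"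
    using ij by (simp add: seg_def scalar_prod_def atLeast0LessThan)
  show "(?A * ?B) $$ (i, j) = seg n (d + d') (max k (k' - d)) (min m (m' - d)) $$ (i, j)"
  proof (cases "k \<le> int i + 1 \<and> int i + 1 \<le> m")
    case True
    define p where "p = nat (int i + d)"
    have p: "p < n" "int p = int i + d"
      using True assms by (auto simp: p_def admissible_def)
    have "(\<Sum>l<n. ?A $$ (i, l) * ?B $$ (l, j)) = (\<Sum>l<n. if l = p then ?B $$ (l, j) else 0)"
      using True ij p by (intro sum.cong) (auto simp: seg_def)
    also have "\<dots> = ?B $$ (p, j)" using p by simp
    finally show ?thesis using e True ij p by (auto simp: seg_def)
  next
    case False
    then have "(\<Sum>l<n. ?A $$ (i, l) * ?B $$ (l, j)) = 0"
      using ij by (intro sum.neutral) (auto simp: seg_def)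
    then show ?thesis using e False ij by (auto simp: seg_def)
  qed
qed (auto simp: seg_def)

lemma M_set_carrier: "x \<in> M_set n \<Longrightarrow> x \<in> carrier_mat n n"
  by (auto simp: M_set_def restricted_def)

lemma M_set_closed:
  assumes "x \<in> M_set n" and "y \<in> M_set n"
  shows "x * y \<in> M_set n"
proof (cases "x = 0\<^sub>m n n \<or> y = 0\<^sub>m n n")
  case True
  then have "x * y = 0\<^sub>m n n"
    using assms[THEN M_set_carrier] by auto
  then show ?thesis by (simp add: M_set_def restricted_def)
next
  case False
  then obtain d k m d' k' m' where
    x: "x = seg n d k m" "admissible n d k m" and y: "y = seg n d' k' m'" "admissible n d' k' m'"
    using assms by (auto simp: M_set_def restricted_def)
  let ?k = "max k (k' - d)" and ?m = "min m (m' - d)"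
  have xy: "x * y = seg n (d + d') ?k ?m" using x y by (simp add: seg_mult)
  show ?thesis
  proof (cases "?k \<le> ?m")
    case True
    then have "admissible n (d + d') ?k ?m"
      using x(2) y(2) by (auto simp: admissible_def)
    then show ?thesis unfolding xy M_set_def restricted_def by blast
  next
    case False
    then have "x * y = 0\<^sub>m n n" unfolding xy by (intro seg_empty) linarith
    then show ?thesis by (simp add: M_set_def restricted_def)
  qed
qed

lemma one_in_M_set: "(1\<^sub>m n :: 'a::semiring_1 mat) \<in> M_set n"
proof (cases "n = 0")
  case True
  then have "(1\<^sub>m n :: 'a mat) = 0\<^sub>m n n" by (intro eq_matI) auto
  then show ?thesis by (simp add: M_set_def restricted_def)
next
  case False
  then have "admissible n 0 1 (int n)" by (simp add: admissible_def)
  then show ?thesis unfolding one_eq_seg M_set_def restricted_def by blast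
qed

lemma monoid_M_monoid: "monoid (M_monoid n)"
proof
  fix x y z :: "'a mat"
  assume "x \<in> carrier (M_monoid n)" "y \<in> carrier (M_monoid n)" "z \<in> carrier (M_monoid n)"
  then show "x \<otimes>\<^bsub>M_monoid n\<^esub> y \<otimes>\<^bsub>M_monoid n\<^esub> z = x \<otimes>\<^bsub>M_monoid n\<^esub> (y \<otimes>\<^bsub>M_monoid n\<^esub> z)"
    by (auto simp: M_monoid_def intro!: assoc_mult_mat dest: M_set_carrier)
qed (auto simp: M_monoid_def M_set_closed one_in_M_set dest: M_set_carrier)

lemma S_set_subsemigroup:
  assumes "n \<ge> 2"
  shows "subsemigroup (S_set n :: 'a::semiring_1 mat set) (M_set n)"
proof -
  have z: "0\<^sub>m n n \<noteq> (1\<^sub>m n :: 'a mat)"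
  proof
    assume "0\<^sub>m n n = (1\<^sub>m n :: 'a mat)"
    then have "0\<^sub>m n n $$ (0, 0) = (1\<^sub>m n :: 'a mat) $$ (0, 0)" by simp
    then show False using assms by simp
  qed
  have "x = 1\<^sub>m n" if x: "x \<in> M_set n" and y: "y \<in> M_set n" and xy: "x * y = 1\<^sub>m n"
    for x y :: "'a mat"
  proof -
    have "x \<noteq> 0\<^sub>m n n" "y \<noteq> 0\<^sub>m n n"
      using xy z x y by (auto dest!: M_set_carrier)
    then obtain d k m d' k' m' where
      X: "x = seg n d k m" "admissible n d k m" and Y: "y = seg n d' k' m'"
      using x y by (auto simp: M_set_def restricted_def)
    have e: "seg n (d + d') (max k (k' - d)) (min m (m' - d)) = (1\<^sub>m n :: 'a mat)"
      using X Y xy by (simp add: seg_mult)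
    have "seg n (d + d') (max k (k' - d)) (min m (m' - d)) $$ (i, i) = (1::'a)" if "i < n" for i
      using that unfolding e by simp
    from this[of 0] this[of "n - 1"] have "k \<le> 1" "int n \<le> m"
      using assms by (auto simp: seg_def of_nat_diff split: if_splits)
    then have "d = 0" "k = 1" "m = int n" using X(2) by (auto simp: admissible_def)
    then show ?thesis using X by (simp add: one_eq_seg)
  qed
  moreover have "0\<^sub>m n n \<in> (S_set n :: 'a mat set)"
    using z by (auto simp: S_set_def M_set_def restricted_def)
  ultimately show ?thesis
    by (auto simp: subsemigroup_def S_set_def M_set_closed)
qed

end

theory Submission
  imports Defs
begin

text \<open>By the product formula for segments, a restriction on \<open>(d, k, m)\<close> cuts out a subsemigroup as
  soon as it is inherited by the parameters of a nonzero product. The product formula also gives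
  \<open>\<langle>d,k,m\<rangle>\<^sup>j\<^sup>+\<^sup>1 = \<langle>(j+1)d, max k (k - jd), min m (m - jd)\<rangle>\<close>, where a void range of rows means
  \<open>\<^bold>0\<close>. The range has length \<open>m - k + 1 - j\<bar>d\<bar>\<close>, so the power vanishes exactly when
  \<open>j \<ge> (m - k + 1) / \<bar>d\<bar>\<close>.\<close>

text \<open>The top entry of the segment, at row \<open>k\<close> and column \<open>k + d\<close> in
  the usual numbering; admissibility puts both in range, so \<open>nat\<close> truncates
  nothing.\<close>

lemma seg_first_entry:
  assumes "admissible n d k m"
  shows "nat (k - 1) < n" "nat (k - 1 + d) < n"
    "(seg n d k m :: 'a::semiring_1 mat) $$ (nat (k - 1), nat (k - 1 + d)) = 1"
  using assms by (auto simp: admissible_def seg_def)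

lemma seg_nonzero:
  assumes "admissible n d k m"
  shows "(seg n d k m :: 'a::semiring_1 mat) \<noteq> 0\<^sub>m n n"
  using seg_first_entry(1,2)[OF assms] seg_first_entry(3)[OF assms, where 'a = 'a] by auto

text \<open>The top entry of the left matrix is 1, so it must lie on diagonal \<open>d'\<close> of
  the right one.\<close>

lemma seg_eq_imp_same_diagonal:
  assumes "admissible n d k m"
    and "seg n d k m = (seg n d' k' m' :: 'a::semiring_1 mat)"
  shows "d = d'"
proof -
  have "(seg n d' k' m' :: 'a mat) $$ (nat (k - 1), nat (k - 1 + d)) = 1"
    using seg_first_entry(3)[OF assms(1), where 'a = 'a] assms(2) by simp
  then show ?thesis
    using seg_first_entry(1,2)[OF assms(1)] assms(1)
    by (auto simp: seg_def admissible_def split: if_splits)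
qed

lemma restricted_subset_M_set: "restricted n P \<subseteq> M_set n"
  by (auto simp: M_set_def restricted_def)

lemma zero_in_restricted: "0\<^sub>m n n \<in> restricted n P"
  by (simp add: restricted_def)

lemma restricted_mult_closed:
  assumes P: "\<And>d k m d' k' m'. \<lbrakk>P d k m; P d' k' m'; admissible n d k m; admissible n d' k' m'\<rbrakk>
      \<Longrightarrow> P (d + d') (max k (k' - d)) (min m (m' - d))"
    and x: "x \<in> restricted n P" and y: "y \<in> restricted n P"
  shows "x * y \<in> restricted n P"
proof (cases "x = 0\<^sub>m n n \<or> y = 0\<^sub>m n n")
  case True
  then have "x * y = 0\<^sub>m n n"
    using x[THEN subsetD[OF restricted_subset_M_set], THEN M_set_carrier]
      y[THEN subsetD[OF restricted_subset_M_set], THEN M_set_carrier] by auto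
  then show ?thesis by (simp add: zero_in_restricted)
next
  case False
  then obtain d k m d' k' m' where
    X: "x = seg n d k m" "admissible n d k m" "P d k m" and
    Y: "y = seg n d' k' m'" "admissible n d' k' m'" "P d' k' m'"
    using x y by (auto simp: restricted_def)
  let ?k = "max k (k' - d)" and ?m = "min m (m' - d)"
  have xy: "x * y = seg n (d + d') ?k ?m" using X Y by (simp add: seg_mult)
  show ?thesis
  proof (cases "?k \<le> ?m")
    case True
    \<comment> \<open>For the lower bound, \<open>k\<close> is at least 1 and \<open>k' - d\<close>
      is at least \<open>1 - d' - d\<close>; dually, \<open>m\<close> is at most \<open>n\<close>
      and \<open>m' - d\<close> at most \<open>n - d' - d\<close>.\<close>
    then have "admissible n (d + d') ?k ?m"
      using X(2) Y(2) by (auto simp: admissible_def)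
    moreover have "P (d + d') ?k ?m" using P X Y by blast
    ultimately show ?thesis unfolding xy restricted_def by blast
  next
    case False
    then have "x * y = 0\<^sub>m n n" unfolding xy by (intro seg_empty) linarith
    then show ?thesis by (simp add: zero_in_restricted)
  qed
qed

lemma subsemigroup_restricted:
  assumes "\<And>d k m d' k' m'. \<lbrakk>P d k m; P d' k' m'; admissible n d k m; admissible n d' k' m'\<rbrakk>
      \<Longrightarrow> P (d + d') (max k (k' - d)) (min m (m' - d))"
  shows "subsemigroup (restricted n P) (M_set n)"
  unfolding subsemigroup_def
  using restricted_subset_M_set zero_in_restricted restricted_mult_closed[of P n] assms by blast

lemma one_in_restricted:
  assumes "n \<ge> 1" and "P 0 1 (int n)"
  shows "1\<^sub>m n \<in> restricted n P"
proof -
  have "admissible n 0 1 (int n)" using assms(1) by (simp add: admissible_def)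
  then show ?thesis using assms(2) unfolding one_eq_seg restricted_def by blast
qed

lemma submonoid_M_monoid:
  assumes "subsemigroup T (M_set n)" and "1\<^sub>m n \<in> T"
  shows "submonoid T (M_monoid n)"
  using assms by (auto simp: submonoid_def subsemigroup_def M_monoid_def)

text \<open>The set is the intersection of \<open>T\<close> with \<open>S_set n\<close>, and both
  are closed under products; the zero matrix keeps it nonempty.\<close>

lemma subsemigroup_remove_one:
  fixes T :: "'a::semiring_1 mat set"
  assumes n: "n \<ge> 2" and T: "subsemigroup T (M_set n)" and z: "0\<^sub>m n n \<in> T"
  shows "subsemigroup (T - {1\<^sub>m n}) (S_set n)"
proof -
  have "0\<^sub>m n n $$ (0, 0) \<noteq> (1\<^sub>m n :: 'a mat) $$ (0, 0)" using n by simp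
  then have "0\<^sub>m n n \<noteq> (1\<^sub>m n :: 'a mat)" by metis
  moreover have "x * y \<noteq> 1\<^sub>m n" if "x \<in> T - {1\<^sub>m n}" "y \<in> T - {1\<^sub>m n}" for x y
    using S_set_subsemigroup[OF n, where 'a = 'a] T that
    by (auto simp: subsemigroup_def S_set_def)
  ultimately show ?thesis
    using T z by (auto simp: subsemigroup_def S_set_def)
qed

text \<open>Matrix powers append the new factor on the right. Peeling it off on the left lets
  \<open>seg_mult\<close>, which asks for admissibility of the left factor, apply even when the
  remaining power has a void row range.\<close>

lemma pow_mat_Suc_left:
  fixes A :: "'a::semiring_1 mat"
  assumes A: "A \<in> carrier_mat n n"
  shows "A ^\<^sub>m Suc j = A * A ^\<^sub>m j"
proof (induction j)
  case 0
  then show ?case using A by simp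
next
  case (Suc j)
  have "A ^\<^sub>m Suc (Suc j) = (A * A ^\<^sub>m j) * A" using Suc by simp
  also have "\<dots> = A * (A ^\<^sub>m j * A)"
    by (rule assoc_mult_mat[OF A pow_carrier_mat[OF A] A])
  finally show ?case by simp
qed

lemma seg_pow_Suc:
  assumes "admissible n d k m"
  shows "(seg n d k m :: 'a::semiring_1 mat) ^\<^sub>m Suc j
    = seg n (int (Suc j) * d) (max k (k - int j * d)) (min m (m - int j * d))"
proof (induction j)
  case 0
  then show ?case by (simp add: seg_def)
next
  case (Suc j)
  \<comment> \<open>The shifts \<open>int j * d\<close> move monotonically away from 0, so the last
    shift dominates in each \<open>max\<close> and \<open>min\<close>. With these signs the claim is
    linear in the product \<open>int j * d\<close>.\<close>
  have "d \<ge> 0 \<Longrightarrow> int j * d \<ge> 0" and "d \<le> 0 \<Longrightarrow> int j * d \<le> 0"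
    by (auto simp: mult_nonneg_nonpos)
  moreover have "int (Suc j) * d = int j * d + d" by (simp add: algebra_simps)
  ultimately have "max k (max k (k - int j * d) - d) = max k (k - int (Suc j) * d)"
    and "min m (min m (m - int j * d) - d) = min m (m - int (Suc j) * d)"
    by linarith+
  moreover have "d + int (Suc j) * d = int (Suc (Suc j)) * d" by (simp add: algebra_simps)
  ultimately show ?case
    unfolding pow_mat_Suc_left[OF seg_carrier, of n d k m "Suc j"] Suc seg_mult[OF assms] by simp
qed

lemma seg_pow_Suc_eq_zero_iff:
  assumes adm: "admissible n d k m"
  shows "(seg n d k m :: 'a::semiring_1 mat) ^\<^sub>m Suc j = 0\<^sub>m n n \<longleftrightarrow> m - k + 1 \<le> int j * \<bar>d\<bar>"
proof -
  let ?k = "max k (k - int j * d)" and ?m = "min m (m - int j * d)"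
  have pos: "d \<ge> 0 \<Longrightarrow> int j * d \<ge> 0" and neg: "d \<le> 0 \<Longrightarrow> int j * d \<le> 0"
    by (auto simp: mult_nonneg_nonpos)
  \<comment> \<open>Only one end moves: the lower row bound drops out of reach for positive
    \<open>d\<close>, so \<open>?m\<close> shrinks; for negative \<open>d\<close> it is
    \<open>?k\<close> that grows.\<close>
  have len: "?m - ?k + 1 = m - k + 1 - int j * \<bar>d\<bar>"
    using pos neg by (cases "d \<ge> 0") auto
  \<comment> \<open>A nonvoid range yields an admissible triple, hence a nonzero power; this is the
    converse of \<open>seg_empty\<close>.\<close>
  have "admissible n (int (Suc j) * d) ?k ?m" if "?k \<le> ?m"
    using that adm pos neg by (cases "d \<ge> 0") (auto simp: admissible_def algebra_simps)
  then have "seg n (int (Suc j) * d) ?k ?m = (0\<^sub>m n n :: 'a mat) \<longleftrightarrow> ?m < ?k"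
    using seg_nonzero seg_empty by (metis not_less)
  then show ?thesis unfolding seg_pow_Suc[OF adm] using len by linarith
qed

lemma seg_pow_eq_zero_iff:
  assumes adm: "admissible n d k m" and d: "d \<noteq> 0" and j: "j \<ge> 1"
  shows "(seg n d k m :: 'a::semiring_1 mat) ^\<^sub>m j = 0\<^sub>m n n
    \<longleftrightarrow> 1 + \<lceil>real_of_int (m - k + 1) / real_of_int \<bar>d\<bar>\<rceil> \<le> int j"
proof -
  \<comment> \<open>The first factor costs no rows and each of the \<open>i\<close> others costs
    \<open>\<bar>d\<bar>\<close>, whence the summand 1 in the index.\<close>
  obtain i where i: "j = Suc i" using j by (cases j) auto
  have "\<lceil>real_of_int (m - k + 1) / real_of_int \<bar>d\<bar>\<rceil> \<le> int i
      \<longleftrightarrow> real_of_int (m - k + 1) \<le> real_of_int (int i * \<bar>d\<bar>)"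
    using d by (simp add: ceiling_le_iff pos_divide_le_eq)
  then show ?thesis
    unfolding i seg_pow_Suc_eq_zero_iff[OF adm] of_int_le_iff by auto
qed

lemma seg_nilpotent:
  assumes adm: "admissible n d k m" and d: "d \<noteq> 0"
  shows "nilpotent_mat n (seg n d k m :: 'a::semiring_1 mat)"
    and "int (nilpotency_index n (seg n d k m :: 'a mat))
      = 1 + \<lceil>real_of_int (m - k + 1) / real_of_int \<bar>d\<bar>\<rceil>"
proof -
  define c where "c = \<lceil>real_of_int (m - k + 1) / real_of_int \<bar>d\<bar>\<rceil>"
  let ?Z = "\<lambda>j. j \<ge> 1 \<and> (seg n d k m :: 'a mat) ^\<^sub>m j = 0\<^sub>m n n"
  have "0 \<le> real_of_int (m - k + 1) / real_of_int \<bar>d\<bar>"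
    using adm by (intro divide_nonneg_nonneg) (auto simp: admissible_def)
  then have c: "c \<ge> 0" unfolding c_def by linarith
  \<comment> \<open>Since \<open>c\<close> is nonnegative, the threshold is at least 1, so both
    sides fail at \<open>j = 0\<close>. Existence and minimality are then read off the
    threshold.\<close>
  have Z: "?Z j \<longleftrightarrow> nat (1 + c) \<le> j" for j
    using seg_pow_eq_zero_iff[OF adm d, of j, where 'a = 'a] c
    unfolding c_def[symmetric] by (cases "j \<ge> 1") auto
  show "nilpotent_mat n (seg n d k m :: 'a mat)"
    unfolding nilpotent_mat_def using Z by blast
  have "nilpotency_index n (seg n d k m :: 'a mat) = nat (1 + c)"
    unfolding nilpotency_index_def Z by (rule Least_equality) auto
  then show "int (nilpotency_index n (seg n d k m :: 'a mat))
      = 1 + \<lceil>real_of_int (m - k + 1) / real_of_int \<bar>d\<bar>\<rceil>"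
    using c unfolding c_def[symmetric] by simp
qed

lemma restricted_nilpotent:
  assumes P: "\<And>d k m. P d k m \<Longrightarrow> d \<noteq> 0"
  shows "\<forall>x \<in> (restricted n P :: 'a::semiring_1 mat set). nilpotent_mat n x"
    and "\<forall>d k m. admissible n d k m \<and> seg n d k m \<in> (restricted n P :: 'a mat set) \<longrightarrow>
      int (nilpotency_index n (seg n d k m :: 'a mat))
        = 1 + \<lceil>real_of_int (m - k + 1) / real_of_int \<bar>d\<bar>\<rceil>"
proof -
  have "(0\<^sub>m n n :: 'a mat) ^\<^sub>m 1 = 0\<^sub>m n n" by simp
  then have "nilpotent_mat n (0\<^sub>m n n :: 'a mat)" unfolding nilpotent_mat_def by blast
  then show "\<forall>x \<in> (restricted n P :: 'a mat set). nilpotent_mat n x"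
    using P by (auto simp: restricted_def intro: seg_nilpotent(1))
next
  \<comment> \<open>Membership supplies some triple satisfying \<open>P\<close>, possibly other than
    the given one; equality of the diagonals carries \<open>d' \<noteq> 0\<close> over to
    \<open>d\<close>.\<close>
  have "d \<noteq> 0" if adm: "admissible n d k m"
    and mem: "seg n d k m \<in> (restricted n P :: 'a mat set)" for d k m
  proof -
    obtain d' k' m' where "P d' k' m'" "seg n d k m = (seg n d' k' m' :: 'a mat)"
      using mem seg_nonzero[OF adm, where 'a = 'a] by (auto simp: restricted_def)
    then show ?thesis using P seg_eq_imp_same_diagonal[OF adm] by blast
  qed
  then show "\<forall>d k m. admissible n d k m \<and> seg n d k m \<in> (restricted n P :: 'a mat set) \<longrightarrow>
      int (nilpotency_index n (seg n d k m :: 'a mat))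
        = 1 + \<lceil>real_of_int (m - k + 1) / real_of_int \<bar>d\<bar>\<rceil>"
    using seg_nilpotent(2) by blast
qed

theorem theorem12:
  fixes n :: nat
  assumes "n \<ge> 2"
  shows "(\<forall>T \<in> {UT_set n, SUT_set n, UF_set n, SUF_set n, LT_set n, SLT_set n,
                 LF_set n, SLF_set n, D_set n :: 'a::semiring_1 mat set}.
            subsemigroup T (M_set n))
       \<and> (\<forall>T \<in> {UT_set n, UF_set n, LT_set n, LF_set n, D_set n :: 'a mat set}.
            1\<^sub>m n \<in> T \<and> submonoid T (M_monoid n) \<and> subsemigroup (T - {1\<^sub>m n}) (S_set n))
       \<and> (\<forall>T \<in> {SUT_set n, SUF_set n, SLT_set n, SLF_set n :: 'a mat set}.
            (\<forall>x \<in> T. nilpotent_mat n x) \<and>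
            (\<forall>d k m. admissible n d k m \<and> seg n d k m \<in> T \<longrightarrow>
               int (nilpotency_index n (seg n d k m :: 'a mat))
                 = 1 + \<lceil>real_of_int (m - k + 1) / real_of_int \<bar>d\<bar>\<rceil>))"
proof (intro conjI)
  note set_defs = UT_set_def SUT_set_def UF_set_def SUF_set_def LT_set_def SLT_set_def
    LF_set_def SLF_set_def D_set_def
  show semigroups: "\<forall>T \<in> {UT_set n, SUT_set n, UF_set n, SUF_set n, LT_set n, SLT_set n,
      LF_set n, SLF_set n, D_set n :: 'a mat set}. subsemigroup T (M_set n)"
    unfolding set_defs ball_simps
    \<comment> \<open>Signs of diagonals survive addition. Full diagonals stay full: for nonnegative
      \<open>d\<close>, \<open>d'\<close>, \<open>max 1 (1 - d)\<close> is 1 and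
      \<open>min (n - d) (n - d' - d)\<close> is \<open>n - (d + d')\<close>; the lower case is
      symmetric.\<close>
    by (intro conjI TrueI subsemigroup_restricted) auto
  have ones: "\<forall>T \<in> {UT_set n, UF_set n, LT_set n, LF_set n, D_set n :: 'a mat set}.
      1\<^sub>m n \<in> T \<and> 0\<^sub>m n n \<in> T"
    unfolding set_defs ball_simps
    using assms by (intro conjI TrueI one_in_restricted zero_in_restricted) auto
  show "\<forall>T \<in> {UT_set n, UF_set n, LT_set n, LF_set n, D_set n :: 'a mat set}.
      1\<^sub>m n \<in> T \<and> submonoid T (M_monoid n) \<and> subsemigroup (T - {1\<^sub>m n}) (S_set n)"
  proof
    fix T assume T: "T \<in> {UT_set n, UF_set n, LT_set n, LF_set n, D_set n :: 'a mat set}"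
    then have "subsemigroup T (M_set n)" "1\<^sub>m n \<in> T" "0\<^sub>m n n \<in> T"
      using semigroups ones by blast+
    then show "1\<^sub>m n \<in> T \<and> submonoid T (M_monoid n) \<and> subsemigroup (T - {1\<^sub>m n}) (S_set n)"
      using submonoid_M_monoid subsemigroup_remove_one[OF assms] by blast
  qed
  show "\<forall>T \<in> {SUT_set n, SUF_set n, SLT_set n, SLF_set n :: 'a mat set}.
      (\<forall>x \<in> T. nilpotent_mat n x) \<and>
      (\<forall>d k m. admissible n d k m \<and> seg n d k m \<in> T \<longrightarrow>
         int (nilpotency_index n (seg n d k m :: 'a mat))
           = 1 + \<lceil>real_of_int (m - k + 1) / real_of_int \<bar>d\<bar>\<rceil>)"
    unfolding set_defs ball_simps
    by (intro conjI TrueI restricted_nilpotent) auto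
qed

end
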